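(* Let $n$ be a perfect square. Suppose Alice receives a uniformly random matrix $M\in\mathbb{F}_2^{\sqrt n\times\sqrt n}$ and Bob receives a uniformly random pair $(u,v)\in\mathbb{F}_2^{\sqrt n}\times\mathbb{F}_2^{\sqrt n}$, independent of $M$. Suppose Alice sends Bob a single message that is a deterministic function of $M$, and Bob outputs a bit that is a deterministic function of the message and $(u,v)$, such that \[\Pr_{M,u,v}[\text{Bob's output equals } u^{T}Mv]\ \ge\ \frac12+\frac{1}{2^{\sqrt n/8}}.\] Then Alice must communicate at least $n/10$ bits.
   Context: All arithmetic is over $\mathbb{F}_2$; $u^{T}Mv\in\mathbb{F}_2$. The number of bits communicated is the (maximum) length of Alice's message. *)

theory Defs
  imports
    "HOL-Library.Z2"
    "HOL-Probability.Probability_Mass_Function"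
    "Jordan_Normal_Form.Matrix"
begin

text \<open>
  The field with two elements is the type \<open>bit\<close>.  The name \<open>scalar_prod\<close> is written out because the
  infix dot of the matrix library is also the real inner product.
\<close>

definition bilin :: "bit vec \<Rightarrow> bit mat \<Rightarrow> bit vec \<Rightarrow> bit" where
  "bilin u M v = scalar_prod u (M *\<^sub>v v)"

text \<open>
  Inputs of the two players for dimension \<open>m\<close>.  Note that \<open>pmf_of_set\<close> is the uniform distribution
  only on finite nonempty sets; the lemmas below confirm this for the sets used here.
\<close>

definition alice_input :: "nat \<Rightarrow> bit mat pmf" where
  "alice_input m = pmf_of_set (carrier_mat m m)"

definition bob_input :: "nat \<Rightarrow> (bit vec \<times> bit vec) pmf" where
  "bob_input m = pmf_of_set (carrier_vec m \<times> carrier_vec m)"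

text \<open>
  A deterministic one-way protocol is a pair of functions: \<open>alice\<close> maps her matrix to a message (a
  bit string, whose length may depend on the matrix) and \<open>bob\<close> maps the message and his pair of
  vectors to an output bit.  Independence of the inputs is expressed by \<open>pair_pmf\<close>.
\<close>

definition success_prob ::
  "nat \<Rightarrow> (bit mat \<Rightarrow> bool list) \<Rightarrow> (bool list \<Rightarrow> bit vec \<times> bit vec \<Rightarrow> bit) \<Rightarrow> real" where
  "success_prob m alice bob =
     measure_pmf.prob (pair_pmf (alice_input m) (bob_input m))
       {(M, (u, v)). bob (alice M) (u, v) = bilin u M v}"

definition comm_bits :: "nat \<Rightarrow> (bit mat \<Rightarrow> bool list) \<Rightarrow> nat" where
  "comm_bits m alice = Max ((\<lambda>M. length (alice M)) ` carrier_mat m m)"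

lemma finite_UNIV_bit: "finite (UNIV :: bit set)"
proof -
  have "(UNIV :: bit set) = {0, 1}"
    by (metis (full_types) UNIV_eq_I bit_not_one_iff insert_iff)
  then show ?thesis by (metis finite.emptyI finite.insertI)
qed

lemma finite_carrier_mat_bit: "finite (carrier_mat m k :: bit mat set)"
proof -
  let ?F = "PiE ({..<m} \<times> {..<k}) (\<lambda>_. UNIV :: bit set)"
  have "finite ?F"
    by (intro finite_PiE finite_cartesian_product finite_lessThan finite_UNIV_bit)
  moreover have "carrier_mat m k \<subseteq> mat m k ` ?F"
  proof
    fix A :: "bit mat" assume A: "A \<in> carrier_mat m k"
    let ?f = "restrict (\<lambda>ij. A $$ ij) ({..<m} \<times> {..<k})"
    have "A = mat m k ?f" using A by (intro eq_matI) simp_all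
    moreover have "?f \<in> ?F" by simp
    ultimately show "A \<in> mat m k ` ?F" by (rule image_eqI)
  qed
  ultimately show ?thesis by (meson finite_imageI finite_subset)
qed

lemma finite_carrier_vec_bit: "finite (carrier_vec m :: bit vec set)"
proof -
  let ?F = "PiE {..<m} (\<lambda>_. UNIV :: bit set)"
  have "finite ?F"
    by (intro finite_PiE finite_lessThan finite_UNIV_bit)
  moreover have "carrier_vec m \<subseteq> vec m ` ?F"
  proof
    fix w :: "bit vec" assume w: "w \<in> carrier_vec m"
    let ?f = "restrict (vec_index w) {..<m}"
    have "w = vec m ?f" using w by (intro eq_vecI) simp_all
    moreover have "?f \<in> ?F" by simp
    ultimately show "w \<in> vec m ` ?F" by (rule image_eqI)
  qed
  ultimately show ?thesis by (meson finite_imageI finite_subset)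
qed

lemma set_pmf_alice_input: "set_pmf (alice_input m) = carrier_mat m m"
proof -
  have "(0\<^sub>m m m :: bit mat) \<in> carrier_mat m m" by simp
  then have "carrier_mat m m \<noteq> ({} :: bit mat set)" by blast
  then show ?thesis
    unfolding alice_input_def using finite_carrier_mat_bit by (intro set_pmf_of_set)
qed

lemma set_pmf_bob_input: "set_pmf (bob_input m) = carrier_vec m \<times> carrier_vec m"
proof -
  have "(0\<^sub>v m :: bit vec) \<in> carrier_vec m" by simp
  then have "carrier_vec m \<times> carrier_vec m \<noteq> ({} :: (bit vec \<times> bit vec) set)" by blast
  then show ?thesis
    unfolding bob_input_def using finite_carrier_vec_bit
    by (intro set_pmf_of_set finite_cartesian_product)
qed

end

theory Submission
  imports Defs
begin

text \<open>
  On the set \<open>S\<close> of matrices sharing a message, Bob's correlation with \<open>bilin\<close> is controlled by the second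
  moment of the character sum over \<open>S\<close>, which equals \<open>2 ^ m\<close> times the sum of the kernel sizes of \<open>M + L\<close>
  for \<open>M\<close>, \<open>L\<close> in \<open>S\<close>.  Few matrices have a kernel with at least \<open>2 ^ t\<close> elements: such a kernel contains
  at least \<open>2 ^ (t * (t - 1))\<close> independent \<open>t\<close>-tuples, while each independent \<open>t\<close>-tuple is killed by at most a
  fraction \<open>1 / 2 ^ (m * t)\<close> of all matrices.  Taking \<open>t\<close> close to \<open>3 * m / 4\<close> bounds the advantage of any
  protocol with fewer than \<open>m\<^sup>2 / 10\<close> bits.  For \<open>m < 8\<close> the required success probability exceeds 1.
\<close>

section \<open>Addition in characteristic two and the number of vectors\<close>

lemma bit_add_cancel: "a + (a + b) = (b :: bit)"
  by (cases a; cases b) simp_all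

lemma bit_vec_add_cancel:
  fixes u v :: "bit vec"
  assumes "u \<in> carrier_vec m" "v \<in> carrier_vec m"
  shows "u + (u + v) = v"
  using assms by (intro eq_vecI) (simp_all add: bit_add_cancel del: add_bit_eq_xor)

lemma bit_mat_add_cancel:
  fixes A B :: "bit mat"
  assumes "A \<in> carrier_mat m k" "B \<in> carrier_mat m k"
  shows "A + (A + B) = B"
  using assms by (intro eq_matI) (simp_all add: bit_add_cancel del: add_bit_eq_xor)

lemma inj_on_bit_mat_add:
  fixes A :: "bit mat"
  assumes "A \<in> carrier_mat m k"
  shows "inj_on ((+) A) (carrier_mat m k)"
  by (rule inj_on_inverseI [where g = "(+) A"]) (rule bit_mat_add_cancel [OF assms])

lemma card_carrier_vec_bit: "card (carrier_vec m :: bit vec set) = 2 ^ m"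
proof -
  have "(UNIV :: bit set) = {0, 1}"
    using bit_not_zero_iff by auto
  then have U: "card (UNIV :: bit set) = 2"
    by (metis card_2_iff zero_neq_one)
  have "bij_betw (vec m) (PiE {..<m} (\<lambda>_. UNIV :: bit set)) (carrier_vec m)"
  proof (rule bij_betw_byWitness [where f' = "\<lambda>w. restrict (vec_index w) {..<m}"])
    show "\<forall>f \<in> PiE {..<m} (\<lambda>_. UNIV :: bit set). restrict (vec_index (vec m f)) {..<m} = f"
      by (auto simp: PiE_def extensional_def fun_eq_iff)
    show "\<forall>w \<in> carrier_vec m. vec m (restrict (vec_index w) {..<m}) = (w :: bit vec)"
      by (auto intro!: eq_vecI)
  qed (simp_all add: image_subset_iff)
  then have "card (carrier_vec m :: bit vec set) = card (PiE {..<m} (\<lambda>_. UNIV :: bit set))"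
    by (simp add: bij_betw_same_card)
  also have "\<dots> = 2 ^ m"
    by (simp add: card_PiE U)
  finally show ?thesis .
qed


section \<open>Character sums over the field with two elements\<close>

definition bsign :: "bit \<Rightarrow> real" where
  "bsign b = (if b = 0 then 1 else - 1)"

lemma bsign_simps [simp]: "bsign 0 = 1" "bsign 1 = - 1"
  by (simp_all add: bsign_def)

lemma bsign_add: "bsign (a + b) = bsign a * bsign b"
  by (cases a; cases b) simp_all

lemma bsign_mult_eq: "bsign a * bsign b = 2 * of_bool (a = b) - 1"
  by (cases a; cases b) simp_all

lemma abs_bsign: "\<bar>bsign a\<bar> = 1"
  by (simp add: bsign_def)

text \<open>Orthogonality of characters: if \<open>w\<close> has a nonzero entry \<open>i\<close>,
  translating \<open>u\<close> by the unit vector \<open>i\<close> permutes the space and flips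
  every sign, so the sum equals its own negative.\<close>

lemma sum_bsign_scalar_prod:
  assumes w: "w \<in> carrier_vec m"
  shows "(\<Sum>u\<in>carrier_vec m. bsign (scalar_prod u w)) = 2 ^ m * of_bool (w = 0\<^sub>v m)"
proof (cases "w = 0\<^sub>v m")
  case True
  then show ?thesis by (simp add: bsign_def card_carrier_vec_bit)
next
  case False
  then obtain i where i: "i < m" "w $ i \<noteq> 0"
    using w by (metis carrier_vecD eq_vecI index_zero_vec(1) index_zero_vec(2))
  let ?e = "unit_vec m i :: bit vec" and ?f = "\<lambda>u. bsign (scalar_prod u w)"
  have e: "scalar_prod ?e w = 1"
    using i w by (simp add: scalar_prod_left_unit)
  have "sum ?f (carrier_vec m) = (\<Sum>u\<in>carrier_vec m. ?f (?e + u))"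
    by (rule sum.reindex_bij_witness [where i = "(+) ?e" and j = "(+) ?e"])
       (auto simp: bit_vec_add_cancel [of _ m])
  also have "\<dots> = (\<Sum>u\<in>carrier_vec m. - ?f u)"
    by (rule sum.cong) (simp_all add: add_scalar_prod_distrib [OF _ _ w] e bsign_add)
  finally show ?thesis
    using False by (simp add: sum_negf)
qed

definition bker :: "nat \<Rightarrow> bit mat \<Rightarrow> bit vec set" where
  "bker m M = {v \<in> carrier_vec m. M *\<^sub>v v = 0\<^sub>v m}"

lemma bker_subset: "bker m M \<subseteq> carrier_vec m"
  by (auto simp: bker_def)

lemma finite_bker: "finite (bker m M)"
  using bker_subset finite_carrier_vec_bit finite_subset by metis

lemma card_bker_le: "card (bker m M) \<le> 2 ^ m"
  using card_mono [OF finite_carrier_vec_bit bker_subset] by (simp add: card_carrier_vec_bit)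

text \<open>Summing over \<open>u\<close> first, orthogonality applied to the vector
  \<open>M v\<close> leaves a contribution \<open>2 ^ m\<close> exactly for those \<open>v\<close>
  that \<open>M\<close> sends to zero.\<close>

lemma sum_bsign_bilin:
  assumes M: "M \<in> carrier_mat m m"
  shows "(\<Sum>(u, v)\<in>carrier_vec m \<times> carrier_vec m. bsign (bilin u M v)) = 2 ^ m * real (card (bker m M))"
proof -
  have "(\<Sum>(u, v)\<in>carrier_vec m \<times> carrier_vec m. bsign (bilin u M v))
      = (\<Sum>v\<in>carrier_vec m. \<Sum>u\<in>carrier_vec m. bsign (scalar_prod u (M *\<^sub>v v)))"
    unfolding sum.cartesian_product [symmetric] bilin_def by (rule sum.swap)
  also have "\<dots> = (\<Sum>v\<in>carrier_vec m. 2 ^ m * of_bool (M *\<^sub>v v = 0\<^sub>v m))"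
    using M by (intro sum.cong sum_bsign_scalar_prod refl mult_mat_vec_carrier [of _ m m])
  also have "\<dots> = 2 ^ m * real (card (bker m M))"
    by (simp add: sum_distrib_left [symmetric] sum_of_bool_eq finite_carrier_vec_bit bker_def Int_def)
  finally show ?thesis .
qed

lemma bilin_add:
  assumes "u \<in> carrier_vec m" "v \<in> carrier_vec m" "A \<in> carrier_mat m m" "B \<in> carrier_mat m m"
  shows "bilin u (A + B) v = bilin u A v + bilin u B v"
  unfolding bilin_def add_mult_distrib_mat_vec [OF assms(3,4,2)]
  by (rule scalar_prod_add_distrib [OF assms(1) mult_mat_vec_carrier [OF assms(3,2)]
        mult_mat_vec_carrier [OF assms(4,2)]])


section \<open>Matrices with a large kernel are rare\<close>

text \<open>The linear span: the only scalars are 0 and 1, so a new generator adds just one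
  translate of the old span.\<close>

fun bspan :: "nat \<Rightarrow> bit vec list \<Rightarrow> bit vec set" where
  "bspan m [] = {0\<^sub>v m}"
| "bspan m (v # vs) = bspan m vs \<union> (+) v ` bspan m vs"

text \<open>Linear independence for vectors of dimension \<open>m\<close>: in a nontrivial vanishing
  combination, the first vector with coefficient 1 is a sum of later ones. The recursive form suits
  prepending vectors one at a time.\<close>

fun bindep :: "nat \<Rightarrow> bit vec list \<Rightarrow> bool" where
  "bindep m [] \<longleftrightarrow> True"
| "bindep m (v # vs) \<longleftrightarrow> v \<notin> bspan m vs \<and> bindep m vs"

lemma finite_bspan: "finite (bspan m vs)"
  by (induction vs) auto

lemma card_bspan_le: "card (bspan m vs) \<le> 2 ^ length vs"
proof (induction vs)
  case (Cons v vs)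
  have "card (bspan m (v # vs)) \<le> card (bspan m vs) + card ((+) v ` bspan m vs)"
    using card_Un_le by auto
  also have "\<dots> \<le> card (bspan m vs) + card (bspan m vs)"
    by (simp add: card_image_le finite_bspan)
  finally show ?case using Cons by simp
qed simp

text \<open>Supplies the row vector from which \<open>card_killers_Cons\<close> builds its rank one
  matrices. The induction corrects a functional that fails to vanish on the new generator
  \<open>a\<close> by a second functional.\<close>

lemma separating_functional:
  assumes "set vs \<subseteq> carrier_vec m" "v \<in> carrier_vec m" "v \<notin> bspan m vs"
  shows "\<exists>x \<in> carrier_vec m. (\<forall>a \<in> set vs. scalar_prod x a = 0) \<and> scalar_prod x v = 1"
  using assms
proof (induction vs arbitrary: v)
  case Nil
  then obtain i where i: "i < m" "v $ i \<noteq> 0"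
    by (metis bspan.simps(1) carrier_vecD eq_vecI index_zero_vec(1) index_zero_vec(2) singletonI)
  then have "scalar_prod (unit_vec m i) v = 1"
    using Nil by (simp add: scalar_prod_left_unit)
  then show ?case by (intro bexI [of _ "unit_vec m i"]) simp_all
next
  case (Cons a vs)
  have a: "a \<in> carrier_vec m" and v: "v \<in> carrier_vec m" and vs: "set vs \<subseteq> carrier_vec m"
    using Cons.prems by auto
  \<comment> \<open>The span of \<open>a # vs\<close> contains the translate by \<open>a\<close>, so
    \<open>a + v\<close> also avoids the span of \<open>vs\<close>, and the induction hypothesis can
    be used a second time.\<close>
  have "a + v \<notin> bspan m vs"
    using Cons.prems bit_vec_add_cancel [OF a v] by (metis UnCI bspan.simps(2) image_eqI)
  then obtain y where y: "y \<in> carrier_vec m" "\<forall>b \<in> set vs. scalar_prod y b = 0"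
      "scalar_prod y (a + v) = 1"
    using Cons.IH [of "a + v"] vs a v by auto
  obtain x where x: "x \<in> carrier_vec m" "\<forall>b \<in> set vs. scalar_prod x b = 0" "scalar_prod x v = 1"
    using Cons.IH [of v] vs v Cons.prems by auto
  have sum: "scalar_prod y a + scalar_prod y v = 1"
    using y(3) scalar_prod_add_distrib [OF y(1) a v] by simp
  have xy: "scalar_prod (x + y) b = scalar_prod x b + scalar_prod y b" if "b \<in> carrier_vec m" for b
    using add_scalar_prod_distrib [OF x(1) y(1) that] .
  consider "scalar_prod x a = 0" | "scalar_prod y a = 0"
    | "scalar_prod x a = 1" "scalar_prod y a = 1"
    by (metis bit_not_zero_iff)
  then show ?case
  proof cases
    case 1
    then show ?thesis using x by (intro bexI [of _ x]) auto
  next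
    case 2
    then show ?thesis using y sum by (intro bexI [of _ y]) auto
  next
    \<comment> \<open>Both functionals take the value 1 at \<open>a\<close>, so their sum vanishes
      there; at \<open>v\<close> the values are 1 and 0, so the sum keeps the value 1.\<close>
    case 3
    then have "scalar_prod y v = 0"
      using sum by (cases "scalar_prod y v") auto
    then show ?thesis
      using 3 x y a v vs xy by (intro bexI [of _ "x + y"]) auto
  qed
qed

section \<open>Matrices annihilating a tuple of vectors\<close>

definition killers :: "nat \<Rightarrow> bit vec list \<Rightarrow> bit mat set" where
  "killers m vs = {M \<in> carrier_mat m m. set vs \<subseteq> bker m M}"

lemma finite_killers: "finite (killers m vs)"
  using finite_carrier_mat_bit by (simp add: killers_def)

text \<open>
  If \<open>x\<close> annihilates \<open>vs\<close> and \<open>scalar_prod x v = 1\<close>, then adding the rank one matrices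
  with rows proportional to \<open>x\<close> to a matrix killing \<open>v # vs\<close> gives pairwise different matrices killing \<open>vs\<close>.
\<close>
lemma card_killers_Cons:
  assumes vs: "set vs \<subseteq> carrier_vec m" and v: "v \<in> carrier_vec m" and nv: "v \<notin> bspan m vs"
  shows "2 ^ m * card (killers m (v # vs)) \<le> card (killers m vs)"
proof -
  obtain x where x: "x \<in> carrier_vec m" "\<forall>a \<in> set vs. scalar_prod x a = 0" "scalar_prod x v = 1"
    using separating_functional [OF vs v nv] by auto
  define P where "P y = mat m m (\<lambda>(i, j). y $ i * x $ j)" for y :: "bit vec"
  have P: "P y \<in> carrier_mat m m" for y by (simp add: P_def)
  have Pa: "P y *\<^sub>v a = scalar_prod x a \<cdot>\<^sub>v y" if "a \<in> carrier_vec m" "y \<in> carrier_vec m" for y a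
    using that x(1)
    by (intro eq_vecI)
       (simp_all add: P_def scalar_prod_def sum_distrib_left sum_distrib_right mult_ac del: mult_bit_eq_and)
  let ?f = "\<lambda>(y, M). M + P y"
  \<comment> \<open>Evaluation at \<open>v\<close> recovers \<open>y\<close>, and then
    \<open>M\<close>, which gives injectivity of \<open>?f\<close>.\<close>
  have val: "(M + P y) *\<^sub>v v = y" if "y \<in> carrier_vec m" "M \<in> killers m (v # vs)" for y M
    using that x v P
    by (auto simp: add_mult_distrib_mat_vec [of _ m m] killers_def bker_def Pa)
  have "inj_on ?f (carrier_vec m \<times> killers m (v # vs))"
  proof (rule inj_onI, clarify)
    fix y M z L
    assume *: "y \<in> carrier_vec m" "M \<in> killers m (v # vs)" "z \<in> carrier_vec m"
      "L \<in> killers m (v # vs)" "M + P y = L + P z"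
    then have "y = z" using val by metis
    moreover from this have "P y + M = P y + L"
      using * P by (auto simp: killers_def comm_add_mat [of _ m m])
    then have "M = L"
      using * inj_on_bit_mat_add [OF P [of y]] by (auto simp: killers_def dest: inj_onD)
    ultimately show "y = z \<and> M = L" by simp
  qed
  moreover have "?f ` (carrier_vec m \<times> killers m (v # vs)) \<subseteq> killers m vs"
    using x v vs P
    by (auto simp: add_mult_distrib_mat_vec [of _ m m] killers_def bker_def Pa subset_iff)
  ultimately have "card ((carrier_vec m :: bit vec set) \<times> killers m (v # vs)) \<le> card (killers m vs)"
    using card_inj_on_le [of ?f "carrier_vec m \<times> killers m (v # vs)" "killers m vs"] finite_killers
    by blast
  then show ?thesis by (simp add: card_cartesian_product card_carrier_vec_bit)
qed

lemma card_killers_le: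
  assumes "set vs \<subseteq> carrier_vec m" "bindep m vs"
  shows "(2 ^ m) ^ length vs * card (killers m vs) \<le> card (carrier_mat m m :: bit mat set)"
  using assms
proof (induction vs)
  case Nil
  then show ?case by (simp add: killers_def)
next
  case (Cons v vs)
  have "(2 ^ m) ^ length (v # vs) * card (killers m (v # vs))
      = (2 ^ m) ^ length vs * (2 ^ m * card (killers m (v # vs)))" by simp
  also have "\<dots> \<le> (2 ^ m) ^ length vs * card (killers m vs)"
    using Cons.prems by (intro mult_left_mono card_killers_Cons) auto
  also have "\<dots> \<le> card (carrier_mat m m :: bit mat set)"
    using Cons by simp
  finally show ?case .
qed

section \<open>Independent tuples in a large set, and double counting\<close>

definition indep_tuples :: "nat \<Rightarrow> nat \<Rightarrow> bit vec set \<Rightarrow> bit vec list set" where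
  "indep_tuples m i K = {vs. length vs = i \<and> set vs \<subseteq> K \<and> bindep m vs}"

lemma finite_indep_tuples: "finite K \<Longrightarrow> finite (indep_tuples m i K)"
  by (rule finite_subset [OF _ finite_lists_length_eq [of K i]]) (auto simp: indep_tuples_def)

text \<open>Greedy choice: \<open>i < t\<close> chosen vectors span at most
  \<open>2 ^ (t - 1)\<close> elements, which is at most half of \<open>K\<close>, so at least
  \<open>2 ^ (t - 1)\<close> candidates remain for the next one.\<close>

lemma card_indep_tuples_ge:
  assumes K: "finite K" "2 ^ t \<le> card K" and "i \<le> t"
  shows "(2 ^ (t - 1)) ^ i \<le> card (indep_tuples m i K)"
  using assms(3)
proof (induction i)
  case 0
  have "indep_tuples m 0 K = {[]}" by (auto simp: indep_tuples_def)
  then show ?case by simp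
next
  case (Suc i)
  let ?S = "SIGMA vs:indep_tuples m i K. K - bspan m vs"
  have ext: "2 ^ (t - 1) \<le> card (K - bspan m vs)" if "vs \<in> indep_tuples m i K" for vs
  proof -
    have "card (bspan m vs) \<le> 2 ^ i"
      using that card_bspan_le [of m vs] by (simp add: indep_tuples_def)
    also have "\<dots> \<le> 2 ^ (t - 1)"
      using Suc.prems by (intro power_increasing) auto
    finally have "2 ^ t - 2 ^ (t - 1) \<le> card K - card (bspan m vs)"
      using K by linarith
    moreover have "(2 :: nat) ^ t = 2 * 2 ^ (t - 1)"
      using Suc.prems by (cases t) auto
    ultimately show ?thesis
      using diff_card_le_card_Diff [OF finite_bspan, of K m vs] by linarith
  qed
  have "(2 ^ (t - 1)) ^ Suc i \<le> (\<Sum>vs\<in>indep_tuples m i K. 2 ^ (t - 1) :: nat)"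
    using Suc by simp
  also have "\<dots> \<le> (\<Sum>vs\<in>indep_tuples m i K. card (K - bspan m vs))"
    using ext by (intro sum_mono)
  also have "\<dots> = card ?S"
    using K by (simp add: finite_indep_tuples)
  also have "\<dots> = card ((\<lambda>(vs, v). v # vs) ` ?S)"
    by (rule card_image [symmetric]) (auto simp: inj_on_def)
  also have "\<dots> \<le> card (indep_tuples m (Suc i) K)"
    using K by (intro card_mono finite_indep_tuples) (auto simp: indep_tuples_def)
  finally show ?case .
qed

text \<open>Double counting of pairs of a matrix \<open>M\<close> with large kernel and an
  independent \<open>t\<close>-tuple inside that kernel: the lower bound counts tuples per matrix,
  the upper bound counts matrices per tuple.\<close>

lemma card_large_kernel_le:
  "2 ^ (t * (t - 1)) * card {M \<in> carrier_mat m m. 2 ^ t \<le> card (bker m M)}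
    \<le> card (carrier_mat m m :: bit mat set)" (is "_ * card ?R \<le> ?N")
proof -
  let ?V = "carrier_vec m :: bit vec set" and ?q = "2 ^ m :: nat"
  have finR: "finite ?R" using finite_carrier_mat_bit by simp
  have finI: "finite (indep_tuples m t ?V)"
    by (rule finite_indep_tuples [OF finite_carrier_vec_bit])
  have "card (indep_tuples m t ?V) \<le> card {vs. set vs \<subseteq> ?V \<and> length vs = t}"
    using finite_lists_length_eq [OF finite_carrier_vec_bit]
    by (intro card_mono) (auto simp: indep_tuples_def)
  also have "\<dots> = ?q ^ t"
    by (simp add: card_lists_length_eq finite_carrier_vec_bit card_carrier_vec_bit)
  finally have cI: "card (indep_tuples m t ?V) \<le> ?q ^ t" .
  have "2 ^ (t * (t - 1)) * card ?R = (\<Sum>M\<in>?R. (2 ^ (t - 1)) ^ t)"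
    by (simp add: power_mult [symmetric] mult.commute)
  also have "\<dots> \<le> (\<Sum>M\<in>?R. card (indep_tuples m t (bker m M)))"
    by (intro sum_mono card_indep_tuples_ge finite_bker) auto
  also have "\<dots> = card (SIGMA M:?R. indep_tuples m t (bker m M))"
    using finR by (simp add: finite_indep_tuples finite_bker)
  also have "\<dots> \<le> card ((\<lambda>(vs, M). (M, vs)) ` (SIGMA vs:indep_tuples m t ?V. killers m vs))"
    using finI finite_killers
    by (intro card_mono finite_imageI finite_SigmaI)
       (auto simp: indep_tuples_def killers_def image_iff, use bker_subset in blast)
  also have "\<dots> \<le> card (SIGMA vs:indep_tuples m t ?V. killers m vs)"
    using finI finite_killers by (intro card_image_le finite_SigmaI) auto
  also have "\<dots> = (\<Sum>vs\<in>indep_tuples m t ?V. card (killers m vs))"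
    using finI finite_killers by simp
  \<comment> \<open>There are at most \<open>?q ^ t\<close> tuples and each is killed by at most
    \<open>?N / ?q ^ t\<close> matrices. Scaling by \<open>?q ^ t\<close> avoids division, and the
    factor cancels at the end.\<close>
  finally have "?q ^ t * (2 ^ (t * (t - 1)) * card ?R)
      \<le> (\<Sum>vs\<in>indep_tuples m t ?V. ?q ^ t * card (killers m vs))"
    by (simp add: sum_distrib_left [symmetric])
  also have "\<dots> \<le> (\<Sum>vs\<in>indep_tuples m t ?V. ?N)"
    using card_killers_le [of _ m] by (intro sum_mono) (auto simp: indep_tuples_def)
  also have "\<dots> \<le> ?q ^ t * ?N"
    using cI by simp
  finally show ?thesis by simp
qed

section \<open>The advantage of a protocol\<close>

definition large_kernel :: "nat \<Rightarrow> nat \<Rightarrow> bit mat set" where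
  "large_kernel m t = {M \<in> carrier_mat m m. 2 ^ t \<le> card (bker m M)}"

text \<open>Kernels with fewer than \<open>2 ^ t\<close> elements give the first term. The others
  have at most \<open>2 ^ m\<close> elements, and translation by \<open>M\<close> embeds the set of
  such \<open>L\<close> into \<open>large_kernel m t\<close>.\<close>

lemma sum_card_bker_le:
  assumes S: "S \<subseteq> carrier_mat m m" and M: "M \<in> carrier_mat m m"
  shows "(\<Sum>L\<in>S. real (card (bker m (M + L)))) \<le> real (card S) * 2 ^ t + real (card (large_kernel m t)) * 2 ^ m"
proof -
  let ?B = "{L \<in> S. M + L \<in> large_kernel m t}"
  have fin: "finite S" using S finite_carrier_mat_bit finite_subset by metis
  have "(\<Sum>L\<in>S. real (card (bker m (M + L)))) \<le> (\<Sum>L\<in>S. 2 ^ t + 2 ^ m * of_bool (L \<in> ?B))"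
  proof (rule sum_mono)
    fix L assume L: "L \<in> S"
    show "real (card (bker m (M + L))) \<le> 2 ^ t + 2 ^ m * of_bool (L \<in> ?B)"
    proof (cases "L \<in> ?B")
      case True
      have "real (card (bker m (M + L))) \<le> 2 ^ m"
        using card_bker_le [of m "M + L"] by (metis of_nat_le_iff of_nat_numeral of_nat_power)
      then show ?thesis using True by (simp add: add_increasing)
    next
      case False
      then have "card (bker m (M + L)) < 2 ^ t"
        using L S M by (auto simp: large_kernel_def)
      then have "real (card (bker m (M + L))) \<le> 2 ^ t"
        by (metis less_imp_le of_nat_le_iff of_nat_numeral of_nat_power)
      then show ?thesis using False by auto
    qed
  qed
  also have "\<dots> = real (card S) * 2 ^ t + 2 ^ m * real (card ?B)"
    using fin by (simp add: sum.distrib sum_distrib_left [symmetric] sum_of_bool_eq Int_def)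
  also have "card ?B \<le> card (large_kernel m t)"
  proof (rule card_inj_on_le)
    show "inj_on ((+) M) ?B"
      using inj_on_bit_mat_add [OF M] S by (auto intro: inj_on_subset)
  qed (use finite_carrier_mat_bit in \<open>auto simp: large_kernel_def\<close>)
  finally show ?thesis by (simp add: mult.commute)
qed

text \<open>Expanding the square gives a sum over pairs \<open>M\<close>, \<open>L\<close>; the
  product of their signs is the sign of \<open>bilin u (M + L) v\<close>, so summing over
  \<open>u\<close> and \<open>v\<close> produces the kernel size of \<open>M + L\<close>.\<close>

lemma second_moment_le:
  assumes S: "S \<subseteq> carrier_mat m m"
  shows "(\<Sum>(u, v)\<in>carrier_vec m \<times> carrier_vec m. (\<Sum>M\<in>S. bsign (bilin u M v))\<^sup>2)
    \<le> 2 ^ m * real (card S) * (real (card S) * 2 ^ t + real (card (large_kernel m t)) * 2 ^ m)"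
proof -
  let ?W = "carrier_vec m \<times> carrier_vec m :: (bit vec \<times> bit vec) set"
  have sq: "(\<Sum>M\<in>S. bsign (bilin u M v))\<^sup>2 = (\<Sum>M\<in>S. \<Sum>L\<in>S. bsign (bilin u (M + L) v))"
    if "u \<in> carrier_vec m" "v \<in> carrier_vec m" for u v
    unfolding power2_eq_square sum_product
    using that S by (intro sum.cong refl) (metis bilin_add bsign_add subsetD)
  have "(\<Sum>(u, v)\<in>?W. (\<Sum>M\<in>S. bsign (bilin u M v))\<^sup>2)
      = (\<Sum>p\<in>?W. \<Sum>M\<in>S. \<Sum>L\<in>S. bsign (bilin (fst p) (M + L) (snd p)))"
    by (intro sum.cong refl) (auto simp: sq)
  also have "\<dots> = (\<Sum>M\<in>S. \<Sum>p\<in>?W. \<Sum>L\<in>S. bsign (bilin (fst p) (M + L) (snd p)))"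
    by (rule sum.swap)
  also have "\<dots> = (\<Sum>M\<in>S. \<Sum>L\<in>S. \<Sum>p\<in>?W. bsign (bilin (fst p) (M + L) (snd p)))"
    by (intro sum.cong refl sum.swap)
  also have "\<dots> = (\<Sum>M\<in>S. \<Sum>L\<in>S. 2 ^ m * real (card (bker m (M + L))))"
    using S sum_bsign_bilin [of _ m]
    by (intro sum.cong refl) (auto simp: case_prod_unfold subset_iff)
  also have "\<dots> = 2 ^ m * (\<Sum>M\<in>S. \<Sum>L\<in>S. real (card (bker m (M + L))))"
    by (simp add: sum_distrib_left)
  also have "\<dots> \<le> 2 ^ m * (\<Sum>M\<in>S. real (card S) * 2 ^ t + real (card (large_kernel m t)) * 2 ^ m)"
    using S by (intro mult_left_mono sum_mono sum_card_bker_le) auto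
  finally show ?thesis by (simp add: mult.assoc)
qed

text \<open>Stands in for Cauchy-Schwarz: it trades a signed linear term for a square, with a free
  weight \<open>c\<close>, and avoids square roots.\<close>

lemma weighted_am_gm:
  fixes s h c :: real
  assumes "\<bar>s\<bar> = 1" "0 < c"
  shows "s * h \<le> (c + h\<^sup>2 / c) / 2"
proof -
  have "s\<^sup>2 = 1"
    using assms(1) by (simp add: abs_square_eq_1)
  have "0 \<le> (c - s * h)\<^sup>2" by simp
  also have "\<dots> = c\<^sup>2 - 2 * c * (s * h) + h\<^sup>2"
    using \<open>s\<^sup>2 = 1\<close> by (simp add: power2_diff power_mult_distrib)
  finally have "2 * c * (s * h) \<le> c\<^sup>2 + h\<^sup>2" by simp
  then show ?thesis using assms
    by (simp add: field_simps power2_eq_square)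
qed

text \<open>The weight in \<open>weighted_am_gm\<close> is \<open>r\<close> times the size of
  \<open>S\<close>. Dividing by it cancels one factor \<open>card S\<close> of the second moment, so
  the bound is affine in \<open>card S\<close> and can be summed over all messages.\<close>

lemma correlation_le:
  fixes g :: "bit vec \<times> bit vec \<Rightarrow> bit" and r :: real
  assumes S: "S \<subseteq> carrier_mat m m" "S \<noteq> {}" and r: "0 < r"
  shows "(\<Sum>(u, v)\<in>carrier_vec m \<times> carrier_vec m. bsign (g (u, v)) * (\<Sum>M\<in>S. bsign (bilin u M v)))
    \<le> (4 ^ m * r * card S + 2 ^ m / r * (card S * 2 ^ t + card (large_kernel m t) * 2 ^ m)) / 2"
proof -
  let ?W = "carrier_vec m \<times> carrier_vec m :: (bit vec \<times> bit vec) set"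
  let ?h = "\<lambda>u v. \<Sum>M\<in>S. bsign (bilin u M v)"
  let ?c = "r * real (card S)" and ?X = "real (card S) * 2 ^ t + real (card (large_kernel m t)) * 2 ^ m"
  have "finite S" using S finite_carrier_mat_bit finite_subset by metis
  then have S0: "0 < real (card S)" using S by (simp add: card_gt_0_iff)
  have W: "real (card ?W) = 4 ^ m"
    by (simp add: card_cartesian_product card_carrier_vec_bit power_mult_distrib [symmetric])
  have "(\<Sum>(u, v)\<in>?W. bsign (g (u, v)) * ?h u v) \<le> (\<Sum>(u, v)\<in>?W. (?c + (?h u v)\<^sup>2 / ?c) / 2)"
    using r S0 by (intro sum_mono) (auto intro!: weighted_am_gm simp: abs_bsign)
  also have "\<dots> = (4 ^ m * ?c + (\<Sum>(u, v)\<in>?W. (?h u v)\<^sup>2) / ?c) / 2"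
    using W by (simp add: case_prod_unfold sum_divide_distrib [symmetric] sum.distrib)
  also have "\<dots> \<le> (4 ^ m * ?c + (2 ^ m * real (card S) * ?X) / ?c) / 2"
    using r S0 second_moment_le [OF S(1), of t]
    by (intro divide_right_mono add_left_mono) auto
  also have "2 ^ m * real (card S) * ?X / ?c = 2 ^ m / r * ?X"
    using r S0 by simp
  finally show ?thesis by simp
qed

text \<open>The product of two signs is 1 on agreement and -1 otherwise, so its mean over the
  uniform inputs is twice the success probability minus 1.\<close>

lemma success_prob_eq:
  "(2 * success_prob m alice bob - 1) * (real (card (carrier_mat m m :: bit mat set)) * 4 ^ m)
    = (\<Sum>M\<in>carrier_mat m m. \<Sum>(u, v)\<in>carrier_vec m \<times> carrier_vec m.
        bsign (bob (alice M) (u, v)) * bsign (bilin u M v))"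
proof -
  let ?A = "carrier_mat m m :: bit mat set"
  let ?W = "carrier_vec m \<times> carrier_vec m :: (bit vec \<times> bit vec) set"
  let ?E = "{(M, (u, v)). bob (alice M) (u, v) = bilin u M v}"
  have A: "finite ?A" "?A \<noteq> {}"
    using finite_carrier_mat_bit zero_carrier_mat by blast+
  have W: "finite ?W" "?W \<noteq> {}"
    using finite_carrier_vec_bit zero_carrier_vec by blast+
  have W': "real (card ?W) = 4 ^ m"
    by (simp add: card_cartesian_product card_carrier_vec_bit power_mult_distrib [symmetric])
  have "pair_pmf (alice_input m) (bob_input m) = pmf_of_set (?A \<times> ?W)"
    unfolding alice_input_def bob_input_def
  proof (rule pmf_eqI)
    fix x show "pmf (pair_pmf (pmf_of_set ?A) (pmf_of_set ?W)) x = pmf (pmf_of_set (?A \<times> ?W)) x"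
      using A W by (cases x) (simp add: pmf_pair indicator_def card_cartesian_product)
  qed
  then have "success_prob m alice bob = card ((?A \<times> ?W) \<inter> ?E) / card (?A \<times> ?W)"
    using A W by (simp add: success_prob_def measure_pmf_of_set)
  moreover have N: "real (card (?A \<times> ?W)) = card ?A * 4 ^ m"
    using W' by (simp add: card_cartesian_product)
  moreover have "0 < real (card ?A)" using A by (simp add: card_gt_0_iff)
  ultimately have "(2 * success_prob m alice bob - 1) * (real (card ?A) * 4 ^ m)
      = 2 * real (card ((?A \<times> ?W) \<inter> ?E)) - real (card (?A \<times> ?W))"
    by (simp add: field_simps)
  also have "\<dots> = (\<Sum>x\<in>?A \<times> ?W. 2 * of_bool (x \<in> ?E) - 1)"
    using A W by (simp add: sum_subtractf sum_distrib_left [symmetric] sum_of_bool_eq Int_def)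
  also have "\<dots> = (\<Sum>(M, p)\<in>?A \<times> ?W. bsign (bob (alice M) p) * bsign (bilin (fst p) M (snd p)))"
    by (intro sum.cong refl) (auto simp: bsign_mult_eq)
  also have "\<dots> = (\<Sum>M\<in>?A. \<Sum>p\<in>?W. bsign (bob (alice M) p) * bsign (bilin (fst p) M (snd p)))"
    by (simp add: sum.cartesian_product)
  finally show ?thesis by (simp add: case_prod_unfold)
qed

text \<open>Grouping matrices by their message makes Bob's answer a fixed function of
  \<open>(u, v)\<close> on each class, so \<open>correlation_le\<close> applies class by
  class.\<close>

lemma advantage_le:
  fixes r :: real
  assumes r: "0 < r"
  shows "2 * success_prob m alice bob - 1
    \<le> (r + (2 ^ t / 2 ^ m + card (alice ` carrier_mat m m) / 2 ^ (t * (t - 1))) / r) / 2"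
proof -
  let ?A = "carrier_mat m m :: bit mat set"
  let ?W = "carrier_vec m \<times> carrier_vec m :: (bit vec \<times> bit vec) set"
  let ?S = "\<lambda>a. {M \<in> ?A. alice M = a}"
  let ?N = "real (card ?A)" and ?K = "real (card (alice ` ?A))" and ?R = "real (card (large_kernel m t))"
  have A: "finite ?A" "?A \<noteq> {}"
    using finite_carrier_mat_bit zero_carrier_mat by blast+
  then have N0: "0 < ?N" by (simp add: card_gt_0_iff)
  have N: "(\<Sum>a\<in>alice ` ?A. real (card (?S a))) = ?N"
    using sum.image_gen [OF A(1), of "\<lambda>_. 1 :: real" alice] by simp
  have "(2 * success_prob m alice bob - 1) * (?N * 4 ^ m)
      = (\<Sum>a\<in>alice ` ?A. \<Sum>M\<in>?S a. \<Sum>(u, v)\<in>?W. bsign (bob (alice M) (u, v)) * bsign (bilin u M v))"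
    unfolding success_prob_eq using A(1) by (rule sum.image_gen)
  also have "\<dots> = (\<Sum>a\<in>alice ` ?A. \<Sum>M\<in>?S a. \<Sum>(u, v)\<in>?W. bsign (bob a (u, v)) * bsign (bilin u M v))"
    by (intro sum.cong refl) auto
  also have "\<dots> = (\<Sum>a\<in>alice ` ?A. \<Sum>(u, v)\<in>?W. bsign (bob a (u, v)) * (\<Sum>M\<in>?S a. bsign (bilin u M v)))"
    unfolding case_prod_unfold sum_distrib_left by (intro sum.cong refl sum.swap)
  also have "\<dots> \<le> (\<Sum>a\<in>alice ` ?A. (4 ^ m * r * card (?S a) + 2 ^ m / r * (card (?S a) * 2 ^ t + ?R * 2 ^ m)) / 2)"
  proof (rule sum_mono)
    fix a assume "a \<in> alice ` ?A"
    then show "(\<Sum>(u, v)\<in>?W. bsign (bob a (u, v)) * (\<Sum>M\<in>?S a. bsign (bilin u M v)))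
        \<le> (4 ^ m * r * card (?S a) + 2 ^ m / r * (card (?S a) * 2 ^ t + ?R * 2 ^ m)) / 2"
      using correlation_le [of "?S a" m r "bob a" t] r by fastforce
  qed
  \<comment> \<open>The classes partition all matrices, so terms linear in the class size add up to
    \<open>?N\<close>; the term free of it occurs once per message, whence the factor
    \<open>?K\<close>.\<close>
  also have "\<dots> = (4 ^ m * r * ?N + 2 ^ m / r * (?N * 2 ^ t + ?K * (?R * 2 ^ m))) / 2"
    unfolding N [symmetric]
    by (simp add: sum_divide_distrib [symmetric] sum.distrib sum_distrib_left [symmetric]
        sum_distrib_right [symmetric])
  also have "\<dots> = (r + (2 ^ t / 2 ^ m + ?K * (?R / ?N)) / r) / 2 * (?N * 4 ^ m)"
  proof -
    have "(4 :: real) ^ m = 2 ^ m * 2 ^ m" by (simp add: power_mult_distrib [symmetric])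
    then show ?thesis using N0 r by (simp add: field_simps)
  qed
  also have "\<dots> \<le> (r + (2 ^ t / 2 ^ m + ?K * (1 / 2 ^ (t * (t - 1)))) / r) / 2 * (?N * 4 ^ m)"
  proof -
    have "real (2 ^ (t * (t - 1)) * card (large_kernel m t)) \<le> ?N"
      using card_large_kernel_le [of t m] unfolding large_kernel_def of_nat_le_iff .
    then have "?R / ?N \<le> 1 / 2 ^ (t * (t - 1))"
      using N0 by (simp add: field_simps)
    then show ?thesis using r N0
      by (intro mult_right_mono divide_right_mono add_left_mono mult_left_mono) auto
  qed
  finally show ?thesis using N0 by simp
qed

section \<open>Counting messages and choosing the parameters\<close>

lemma card_messages_less: "card (alice ` carrier_mat m m) < 2 ^ Suc (comm_bits m alice)"
proof -
  let ?L = "comm_bits m alice"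
  have "length (alice M) \<le> ?L" if "M \<in> carrier_mat m m" for M
    unfolding comm_bits_def using that finite_carrier_mat_bit by (intro Max_ge) auto
  then have "alice ` carrier_mat m m \<subseteq> {xs. set xs \<subseteq> (UNIV :: bool set) \<and> length xs \<le> ?L}"
    by auto
  then have "card (alice ` carrier_mat m m) \<le> card {xs. set xs \<subseteq> (UNIV :: bool set) \<and> length xs \<le> ?L}"
    by (intro card_mono finite_lists_length_le) simp_all
  \<comment> \<open>Messages may have any length up to \<open>?L\<close>, not only \<open>?L\<close>
    itself; the geometric sum costs just a factor 2.\<close>
  also have "\<dots> = (\<Sum>i\<le>?L. 2 ^ i)"
    by (subst card_lists_length_le) simp_all
  also have "\<dots> < 2 ^ Suc ?L"
  proof -
    have "(\<Sum>i\<le>k. 2 ^ i) < (2 :: nat) ^ Suc k" for k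
      by (induction k) auto
    then show ?thesis .
  qed
  finally show ?thesis .
qed

theorem theorem4p1:
  fixes n m :: nat
    and alice :: "bit mat \<Rightarrow> bool list"
    and bob :: "bool list \<Rightarrow> bit vec \<times> bit vec \<Rightarrow> bit"
  assumes "n = m ^ 2"
    and "success_prob m alice bob \<ge> 1 / 2 + 1 / 2 powr (sqrt (real n) / 8)"
  shows "real (comm_bits m alice) \<ge> real n / 10"
proof (rule ccontr)
  define L where "L = comm_bits m alice"
  \<comment> \<open>Since \<open>sqrt n = m\<close>, this is the assumed advantage over 1/2; it also
    serves as the weight in \<open>advantage_le\<close>.\<close>
  define r :: real where "r = 2 powr (- real m / 8)"
  \<comment> \<open>Small enough that \<open>2 ^ t / 2 ^ m\<close> is at most \<open>r * r\<close>,
    and large enough that \<open>t * (t - 1)\<close>, about 9/16 of the square of \<open>m\<close>,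
    dominates the message length.\<close>
  define t where "t = 3 * m div 4"
  assume "\<not> real (comm_bits m alice) \<ge> real n / 10"
  then have L: "real L < (real m)\<^sup>2 / 10"
    using assms(1) by (simp add: L_def)
  have r0: "0 < r" by (simp add: r_def)
  have adv: "1 / 2 + r \<le> success_prob m alice bob"
    using assms by (simp add: r_def powr_minus_divide)
  \<comment> \<open>For smaller \<open>m\<close> the advantage \<open>r\<close> exceeds 1/2, which
    would force a probability above 1.\<close>
  have m: "8 \<le> m"
  proof (rule ccontr)
    assume "\<not> 8 \<le> m"
    then have "2 powr (-1) < r" unfolding r_def by (intro powr_less_mono) auto
    moreover have "success_prob m alice bob \<le> 1" by (simp add: success_prob_def)
    ultimately show False using adv by (simp add: powr_minus_divide)
  qed
  have r2: "r * r = 2 powr (- real m / 4)"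
    by (simp add: r_def powr_add [symmetric])
  have "(2 :: real) ^ t / 2 ^ m = 2 powr (real t - real m)"
    by (simp add: powr_diff powr_realpow)
  also have "\<dots> \<le> r * r"
    unfolding r2 by (intro powr_mono) (auto simp: t_def)
  finally have ker: "(2 :: real) ^ t / 2 ^ m \<le> r * r" .
  have exponent: "real L - real (t * (t - 1)) \<le> - real m / 4"
  proof -
    \<comment> \<open>Rounding down loses at most 3/4.\<close>
    have t: "(3 * real m - 3) / 4 \<le> real t" "1 \<le> t" using m by (auto simp: t_def)
    have "(3 * real m - 3) / 4 * ((3 * real m - 7) / 4) \<le> real t * (real t - 1)"
      using t m by (intro mult_mono) auto
    moreover have "real (t * (t - 1)) = real t * (real t - 1)"
      using t by (simp add: of_nat_diff)
    moreover have "(real m)\<^sup>2 / 10 + real m / 4 \<le> (3 * real m - 3) / 4 * ((3 * real m - 7) / 4)"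
    proof -
      define q where "q = (real m)\<^sup>2"
      have "8 * real m \<le> q" "8 \<le> real m"
        using m by (auto simp: q_def power2_eq_square intro: mult_right_mono)
      have eq: "(3 * real m - 3) / 4 * ((3 * real m - 7) / 4) = (9 * q - 30 * real m + 21) / 16"
        by (simp add: q_def field_simps power2_eq_square)
      show ?thesis
        unfolding eq q_def [symmetric] using \<open>8 * real m \<le> q\<close> \<open>8 \<le> real m\<close> by (simp add: field_simps)
    qed
    ultimately show ?thesis using L by linarith
  qed
  have "real (card (alice ` carrier_mat m m)) < 2 ^ Suc L"
    using card_messages_less [of alice m] unfolding L_def
    by (metis of_nat_less_iff of_nat_numeral of_nat_power)
  then have "real (card (alice ` carrier_mat m m)) / 2 ^ (t * (t - 1)) < 2 ^ Suc L / 2 ^ (t * (t - 1))"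
    by (intro divide_strict_right_mono) auto
  also have "\<dots> = 2 * 2 powr (real L - real (t * (t - 1)))"
    by (simp add: powr_diff powr_realpow del: of_nat_mult)
  also have "\<dots> \<le> 2 * (r * r)"
    unfolding r2 using exponent by (intro mult_left_mono powr_mono) auto
  finally have "2 ^ t / 2 ^ m + real (card (alice ` carrier_mat m m)) / 2 ^ (t * (t - 1)) < 3 * (r * r)"
    using ker by linarith
  \<comment> \<open>The kernel term contributes at most \<open>r * r\<close> and the message term
    less than \<open>2 * (r * r)\<close>. After division by \<open>r\<close> the bound is below
    \<open>(r + 3 * r) / 2 = 2 * r\<close>, while the assumption makes the left side of
    \<open>advantage_le\<close> at least \<open>2 * r\<close>.\<close>
  then have "(r + (2 ^ t / 2 ^ m + card (alice ` carrier_mat m m) / 2 ^ (t * (t - 1))) / r) / 2 < 2 * r"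
    using r0 by (simp add: field_simps)
  then show False
    using advantage_le [OF r0, of m alice bob t] adv by linarith
qed

end
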